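(* Let $Q$ be a quandle and let $<$ be a (strict) linear order on $Q$ that is of type $(R_1,R_2,R_3,R_4)$ for some $(R_1,R_2,R_3,R_4)\in\{=,<,>\}^4$. Then the following hold: (1) $R_1,R_2\in\{<,>\}$. (2) $R_1$ and $R_2$ are the same. (3) The quandle $Q$ is trivial if and only if $R_3$ is the equality $=$, and also if and only if $R_4$ is the equality $=$. (4) The quadruple $(R_1,R_2,R_3,R_4)$ is one of $(<,<,=,=)$, $(<,<,<,>)$, $(<,<,>,<)$, or $(>,>,<,<)$.
   Context: A quandle is a non-empty set $Q$ with a binary operation $*$ such that (Q1) $x*x=x$ for all $x\in Q$; (Q2) for all $x,y\in Q$ there is a unique $z\in Q$ with $x=z*y$; (Q3) $(x*y)*z=(x*z)*(y*z)$ for all $x,y,z\in Q$. The dual operation $*^{-1}$ is defined by $x*^{-1}y=z$ where $z$ is the unique element with $x=z*y$. A quandle is trivial if $x*y=x$ for all $x,y\in Q$. For a quadruple of relation symbols $(R_1,R_2,R_3,R_4)\in\{=,<,>\}^4$, a linear order $<$ on $Q$ is said to be of type $(R_1,R_2,R_3,R_4)$ if for all $x,y,z\in Q$ with $x<y$ one has: $x*z\ R_1\ y*z$; $x*^{-1}z\ R_2\ y*^{-1}z$; $z*x\ R_3\ z*y$; $z*^{-1}x\ R_4\ z*^{-1}y$.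
   Formalization: The quandle Q is assumed to have at least two elements; on a one-element quandle the empty order is vacuously of every type, for example (=,=,=,=), so the claim fails there. *)

theory Defs
  imports Main
begin

locale quandle =
  fixes Q :: "'a set"
    and star :: "'a \<Rightarrow> 'a \<Rightarrow> 'a"  (infixl "\<star>" 70)
  assumes nonempty: "Q \<noteq> {}"
    and closed: "\<And>x y. x \<in> Q \<Longrightarrow> y \<in> Q \<Longrightarrow> x \<star> y \<in> Q"
    and idem: "\<And>x. x \<in> Q \<Longrightarrow> x \<star> x = x"
    and ex1_right_div: "\<And>x y. x \<in> Q \<Longrightarrow> y \<in> Q \<Longrightarrow> \<exists>!z. z \<in> Q \<and> x = z \<star> y"
    and right_distrib: "\<And>x y z. x \<in> Q \<Longrightarrow> y \<in> Q \<Longrightarrow> z \<in> Q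
      \<Longrightarrow> (x \<star> y) \<star> z = (x \<star> z) \<star> (y \<star> z)"

definition quandle_dual :: "'a set \<Rightarrow> ('a \<Rightarrow> 'a \<Rightarrow> 'a) \<Rightarrow> 'a \<Rightarrow> 'a \<Rightarrow> 'a" where
  "quandle_dual Q star x y = (THE z. z \<in> Q \<and> x = star z y)"

definition trivial_quandle :: "'a set \<Rightarrow> ('a \<Rightarrow> 'a \<Rightarrow> 'a) \<Rightarrow> bool" where
  "trivial_quandle Q star \<longleftrightarrow> quandle Q star \<and> (\<forall>x\<in>Q. \<forall>y\<in>Q. star x y = x)"

text \<open>The relation symbols \<open>=\<close>, \<open><\<close>, \<open>>\<close> are kept apart from the relations they denote,
  so that statements such as ``\<open>R\<^sub>3\<close> is the equality'' speak about the symbol.\<close>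

datatype rel_symbol = Eq | Less | Greater

fun rel_of :: "'a rel \<Rightarrow> rel_symbol \<Rightarrow> 'a \<Rightarrow> 'a \<Rightarrow> bool" where
  "rel_of r Eq x y \<longleftrightarrow> x = y"
| "rel_of r Less x y \<longleftrightarrow> (x, y) \<in> r"
| "rel_of r Greater x y \<longleftrightarrow> (y, x) \<in> r"

text \<open>The order is a relation \<open>r\<close>, with \<open>(x, y) \<in> r\<close> for \<open>x < y\<close>.\<close>

definition order_of_type ::
  "'a set \<Rightarrow> ('a \<Rightarrow> 'a \<Rightarrow> 'a) \<Rightarrow> 'a rel
    \<Rightarrow> rel_symbol \<times> rel_symbol \<times> rel_symbol \<times> rel_symbol \<Rightarrow> bool" where
  "order_of_type Q star r = (\<lambda>(R1, R2, R3, R4).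
    \<forall>x\<in>Q. \<forall>y\<in>Q. \<forall>z\<in>Q. (x, y) \<in> r \<longrightarrow>
      rel_of r R1 (star x z) (star y z) \<and>
      rel_of r R2 (quandle_dual Q star x z) (quandle_dual Q star y z) \<and>
      rel_of r R3 (star z x) (star z y) \<and>
      rel_of r R4 (quandle_dual Q star z x) (quandle_dual Q star z y))"

end

theory Submission
  imports Defs
begin

text \<open>Right translations are bijections, so \<open>R\<^sub>1\<close> and \<open>R\<^sub>2\<close> are not \<open>=\<close>, and they agree because
  \<open>x \<mapsto> x *\<^sup>-\<^sup>1 z\<close> inverts \<open>x \<mapsto> x * z\<close>. If \<open>R\<^sub>3\<close> or \<open>R\<^sub>4\<close> is \<open>=\<close>, left translation by \<open>z\<close> is
  constant with value \<open>z * z = z\<close>, so \<open>Q\<close> is trivial. Every other excluded quadruple gives a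
  contradiction for a single pair \<open>x < y\<close>, by comparing \<open>x\<close>, \<open>x * y\<close>, \<open>x *\<^sup>-\<^sup>1 y\<close> and \<open>y\<close>.\<close>

context quandle
begin

abbreviation dual :: "'a \<Rightarrow> 'a \<Rightarrow> 'a"  (infixl "\<diamondop>" 70)
  where "x \<diamondop> y \<equiv> quandle_dual Q (\<star>) x y"

lemma dual_unique:
  assumes "x \<in> Q" "y \<in> Q"
  shows "x \<diamondop> y \<in> Q \<and> x = x \<diamondop> y \<star> y"
  unfolding quandle_dual_def by (rule theI') (rule ex1_right_div[OF assms])

lemma dual_closed: "x \<in> Q \<Longrightarrow> y \<in> Q \<Longrightarrow> x \<diamondop> y \<in> Q"
  and dual_star: "x \<in> Q \<Longrightarrow> y \<in> Q \<Longrightarrow> x \<diamondop> y \<star> y = x"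
  by (simp_all add: dual_unique[THEN conjunct1] dual_unique[THEN conjunct2, symmetric])

lemma star_cancel_right:
  assumes "x \<in> Q" "y \<in> Q" "z \<in> Q" "x \<star> z = y \<star> z"
  shows "x = y"
  using ex1_right_div[OF closed[OF assms(1,3)] assms(3)] assms by blast

text \<open>After right multiplication by \<open>y\<close>, both sides agree by
  \<open>dual_star\<close>, so cancellation suffices.\<close>

lemma star_dual: "x \<in> Q \<Longrightarrow> y \<in> Q \<Longrightarrow> (x \<star> y) \<diamondop> y = x"
  by (rule star_cancel_right[of _ _ y]) (simp_all add: dual_closed dual_star closed)

lemma dual_cancel_right:
  assumes "x \<in> Q" "y \<in> Q" "z \<in> Q" "x \<diamondop> z = y \<diamondop> z"
  shows "x = y"
  using assms by (metis dual_star)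

lemma dual_idem: "x \<in> Q \<Longrightarrow> x \<diamondop> x = x"
  using star_dual[of x x] idem by simp

lemma trivial_iff_star: "trivial_quandle Q (\<star>) \<longleftrightarrow> (\<forall>x\<in>Q. \<forall>y\<in>Q. x \<star> y = x)"
  unfolding trivial_quandle_def using quandle_axioms by blast

text \<open>A right translation is the identity exactly when its inverse is.\<close>

lemma trivial_iff_dual: "trivial_quandle Q (\<star>) \<longleftrightarrow> (\<forall>x\<in>Q. \<forall>y\<in>Q. x \<diamondop> y = x)"
  unfolding trivial_iff_star by (metis dual_star star_dual)

end

text \<open>On a one-element quandle the type condition is vacuous and every quadruple qualifies;
  \<open>two_elements\<close> excludes this case and supplies a pair \<open>x < y\<close> to test
  the symbols on.\<close>

locale ordered_quandle = quandle Q star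
  for Q :: "'a set" and star :: "'a \<Rightarrow> 'a \<Rightarrow> 'a"  (infixl "\<star>" 70) +
  fixes r :: "'a rel" and R1 R2 R3 R4 :: rel_symbol
  assumes two_elements: "\<exists>x\<in>Q. \<exists>y\<in>Q. x \<noteq> y"
    and linear: "strict_linear_order_on Q r"
    and order_type: "order_of_type Q (\<star>) r (R1, R2, R3, R4)"
begin

lemma asym: "(x, y) \<in> r \<Longrightarrow> (y, x) \<notin> r"
  using linear unfolding strict_linear_order_on_def by (meson irreflD transD)

lemma irreflexive: "(x, x) \<notin> r"
  using asym by blast

text \<open>Serves the trivial case, where \<open>star_left\<close> and \<open>dual_left\<close>
  relate an element to itself.\<close>

lemma rel_of_refl_iff: "rel_of r R x x \<longleftrightarrow> R = Eq"
  by (cases R) (simp_all add: irreflexive)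

lemma linear_cases:
  assumes "x \<in> Q" "y \<in> Q"
  obtains "(x, y) \<in> r" | "x = y" | "(y, x) \<in> r"
  using linear assms unfolding strict_linear_order_on_def total_on_def by blast

lemma ex_less:
  obtains x y where "x \<in> Q" "y \<in> Q" "(x, y) \<in> r"
  using two_elements linear_cases by metis

lemma
  assumes "x \<in> Q" "y \<in> Q" "z \<in> Q" "(x, y) \<in> r"
  shows star_right: "rel_of r R1 (x \<star> z) (y \<star> z)"
    and dual_right: "rel_of r R2 (x \<diamondop> z) (y \<diamondop> z)"
    and star_left: "rel_of r R3 (z \<star> x) (z \<star> y)"
    and dual_left: "rel_of r R4 (z \<diamondop> x) (z \<diamondop> y)"
  using order_type assms unfolding order_of_type_def by auto

lemma R1_not_Eq: "R1 \<noteq> Eq"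
proof
  assume "R1 = Eq"
  obtain x y where "x \<in> Q" "y \<in> Q" "(x, y) \<in> r" by (rule ex_less)
  with \<open>R1 = Eq\<close> show False
    using star_right[of x y x] star_cancel_right[of x y x] irreflexive by auto
qed

lemma R2_not_Eq: "R2 \<noteq> Eq"
proof
  assume "R2 = Eq"
  obtain x y where "x \<in> Q" "y \<in> Q" "(x, y) \<in> r" by (rule ex_less)
  with \<open>R2 = Eq\<close> show False
    using dual_right[of x y x] dual_cancel_right[of x y x] irreflexive by auto
qed

lemma R1_eq_R2: "R1 = R2"
proof -
  obtain x y where xy: "x \<in> Q" "y \<in> Q" "(x, y) \<in> r" by (rule ex_less)
  \<comment> \<open>Right translation by \<open>x\<close> carries \<open>u\<close>, \<open>v\<close>
    back to \<open>x\<close>, \<open>y\<close>. As \<open>R2\<close> fixes the order of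
    \<open>u\<close> and \<open>v\<close>, comparison with \<open>x < y\<close> determines
    \<open>R1\<close>.\<close>
  obtain u v where uv: "u = x \<diamondop> x" "v = y \<diamondop> x" by blast
  have Q: "u \<in> Q" "v \<in> Q" and star: "u \<star> x = x" "v \<star> x = y"
    using xy by (simp_all add: uv dual_closed dual_star)
  have R1: "rel_of r R1 x y" if "(u, v) \<in> r"
    using star_right[OF Q xy(1) that] by (simp only: star)
  have R1': "rel_of r R1 y x" if "(v, u) \<in> r"
    using star_right[OF Q(2,1) xy(1) that] by (simp only: star)
  have R2: "rel_of r R2 u v"
    unfolding uv using xy(1,2,1,3) by (rule dual_right)
  show ?thesis
  proof (cases R2)
    case Eq
    with R2_not_Eq show ?thesis by simp
  next
    case Less
    with R1 R2 have "rel_of r R1 x y" by simp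
    with Less R1_not_Eq asym[OF xy(3)] show ?thesis by (cases R1) simp_all
  next
    case Greater
    with R1' R2 have "rel_of r R1 y x" by simp
    with Greater R1_not_Eq asym[OF xy(3)] show ?thesis by (cases R1) simp_all
  qed
qed

lemma trivial_iff_R3: "trivial_quandle Q (\<star>) \<longleftrightarrow> R3 = Eq"
proof
  assume "trivial_quandle Q (\<star>)"
  moreover obtain x y where "x \<in> Q" "y \<in> Q" "(x, y) \<in> r" by (rule ex_less)
  ultimately show "R3 = Eq"
    using star_left[of x y x] by (simp add: trivial_iff_star rel_of_refl_iff)
next
  assume "R3 = Eq"
  \<comment> \<open>Any two distinct elements are comparable, so equality on ordered pairs makes
    each left translation constant.\<close>
  then have "x \<star> y = x \<star> x" if "x \<in> Q" "y \<in> Q" for x y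
    using that star_left[of x y x] star_left[of y x x]
    by (cases rule: linear_cases[OF that]) auto
  then show "trivial_quandle Q (\<star>)"
    by (simp add: trivial_iff_star idem)
qed

lemma trivial_iff_R4: "trivial_quandle Q (\<star>) \<longleftrightarrow> R4 = Eq"
proof
  assume "trivial_quandle Q (\<star>)"
  moreover obtain x y where "x \<in> Q" "y \<in> Q" "(x, y) \<in> r" by (rule ex_less)
  ultimately show "R4 = Eq"
    using dual_left[of x y x] by (simp add: trivial_iff_dual rel_of_refl_iff)
next
  assume "R4 = Eq"
  then have "x \<diamondop> y = x \<diamondop> x" if "x \<in> Q" "y \<in> Q" for x y
    using that dual_left[of x y x] dual_left[of y x x]
    by (cases rule: linear_cases[OF that]) auto
  then show "trivial_quandle Q (\<star>)"
    by (simp add: trivial_iff_dual dual_idem)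
qed

text \<open>Right translations are then identities and cannot reverse the order.\<close>

lemma R1_Less_if_trivial:
  assumes "trivial_quandle Q (\<star>)"
  shows "R1 = Less"
proof -
  obtain x y where "x \<in> Q" "y \<in> Q" "(x, y) \<in> r" by (rule ex_less)
  then show ?thesis
    using assms star_right[of x y x] R1_not_Eq asym[of x y]
    by (cases R1) (auto simp: trivial_iff_star)
qed

lemma R3_not_R4_if_R1_Less:
  assumes "R1 = Less" "R3 \<noteq> Eq"
  shows "R3 \<noteq> R4"
proof
  assume "R3 = R4"
  obtain x y where xy: "x \<in> Q" "y \<in> Q" "(x, y) \<in> r" by (rule ex_less)
  have R2: "R2 = Less" using assms R1_eq_R2 by simp
  \<comment> \<open>Since \<open>x\<close> is idempotent for both operations, equal symbols put
    \<open>x \<star> y\<close> and \<open>x \<diamondop> y\<close> on the same side of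
    \<open>x\<close>.\<close>
  have "rel_of r R3 x (x \<star> y)" "rel_of r R3 x (x \<diamondop> y)"
    using xy star_left[of x y x] dual_left[of x y x] \<open>R3 = R4\<close>
    by (simp_all add: idem dual_idem)
  \<comment> \<open>Right division by \<open>y\<close> is increasing and sends
    \<open>x \<star> y\<close> to \<open>x\<close> and \<open>x\<close> to
    \<open>x \<diamondop> y\<close>, which puts them on opposite sides.\<close>
  moreover have "(x, x \<star> y) \<in> r \<Longrightarrow> (x \<diamondop> y, x) \<in> r" "(x \<star> y, x) \<in> r \<Longrightarrow> (x, x \<diamondop> y) \<in> r"
    using xy dual_right[of x "x \<star> y" y] dual_right[of "x \<star> y" x y]
    by (simp_all add: R2 closed star_dual)
  ultimately show False
    using assms(2) asym[of x "x \<star> y"] asym[of x "x \<diamondop> y"] by (cases R3) auto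
qed

lemma R3_R4_Less_if_R1_Greater:
  assumes "R1 = Greater"
  shows "R3 = Less \<and> R4 = Less"
proof -
  obtain x y where xy: "x \<in> Q" "y \<in> Q" "(x, y) \<in> r" by (rule ex_less)
  have R2: "R2 = Greater" using assms R1_eq_R2 by simp
  have "\<not> trivial_quandle Q (\<star>)" using assms R1_Less_if_trivial by auto
  then have "R3 \<noteq> Eq" "R4 \<noteq> Eq" using trivial_iff_R3 trivial_iff_R4 by auto
  moreover have "R3 \<noteq> Greater"
  proof
    assume "R3 = Greater"
    then have "(x \<star> y, x) \<in> r" using xy star_left[of x y x] by (simp add: idem)
    \<comment> \<open>Reversing \<open>x < y\<close> by right translation with \<open>y\<close>
      fixes \<open>y\<close>, so \<open>y < x \<star> y < x\<close>. The dual operation gives the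
      same chain for \<open>R4\<close>.\<close>
    moreover have "(y, x \<star> y) \<in> r" using xy star_right[of x y y] assms by (simp add: idem)
    ultimately show False
      using linear asym xy(3) unfolding strict_linear_order_on_def by (meson transD)
  qed
  moreover have "R4 \<noteq> Greater"
  proof
    assume "R4 = Greater"
    then have "(x \<diamondop> y, x) \<in> r" using xy dual_left[of x y x] by (simp add: dual_idem)
    moreover have "(y, x \<diamondop> y) \<in> r" using xy dual_right[of x y y] R2 by (simp add: dual_idem)
    ultimately show False
      using linear asym xy(3) unfolding strict_linear_order_on_def by (meson transD)
  qed
  ultimately show ?thesis
    by (cases R3; cases R4) auto
qed

end

theorem theorem3p4:
  fixes Q :: "'a set"
    and star :: "'a \<Rightarrow> 'a \<Rightarrow> 'a"
    and r :: "'a rel"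
    and R1 R2 R3 R4 :: rel_symbol
  assumes "quandle Q star"
    and "\<exists>x\<in>Q. \<exists>y\<in>Q. x \<noteq> y"
    and "strict_linear_order_on Q r"
    and "order_of_type Q star r (R1, R2, R3, R4)"
  shows "(R1 \<in> {Less, Greater} \<and> R2 \<in> {Less, Greater}) \<and>
    R1 = R2 \<and>
    ((trivial_quandle Q star \<longleftrightarrow> R3 = Eq) \<and> (trivial_quandle Q star \<longleftrightarrow> R4 = Eq)) \<and>
    (R1, R2, R3, R4) \<in> {(Less, Less, Eq, Eq), (Less, Less, Less, Greater),
      (Less, Less, Greater, Less), (Greater, Greater, Less, Less)}"
proof -
  interpret ordered_quandle Q star r R1 R2 R3 R4
    using assms by (simp add: ordered_quandle_def ordered_quandle_axioms_def)
  \<comment> \<open>Rules out exactly one equality among \<open>R3\<close>, \<open>R4\<close>; for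
    \<open>R1 = Less\<close> only two equalities or two opposite strict symbols remain.\<close>
  have "R3 = Eq \<longleftrightarrow> R4 = Eq"
    using trivial_iff_R3 trivial_iff_R4 by simp
  then show ?thesis
    using R1_not_Eq R1_eq_R2 trivial_iff_R3 trivial_iff_R4 R1_Less_if_trivial
      R3_not_R4_if_R1_Less R3_R4_Less_if_R1_Greater
    by (cases R1; cases R3; cases R4) auto
qed

end
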